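(* Let $n\ge 2$, $1\le m\le \binom{n}{2}$ and $0\le q\le n$ be integers. Let $\mathcal{G}(n,m)$ be an Erd\H{o}s-R\'enyi graph with $n$ nodes and $m$ edges, and assume that a set of $q$ labeled nodes is selected uniformly at random among the $n$ nodes, independently of the graph. Then the probability of an edge being a starved edge with a two-layer GCN (that is, for two distinct nodes $v,u$, the conditional probability, given that $\{v,u\}$ is an edge of the graph, that the edge $\{v,u\}$ is starved) is equal to $$\left(1-\frac{q}{n}\right)\left(1-\frac{q}{n-1}\right)\prod_{i=1}^{2q}\left(1-\frac{m-1}{\binom{n}{2}-i}\right).$$
   Context: An Erd\H{o}s-R\'enyi graph $\mathcal{G}(n,m)$ is a graph chosen uniformly at random from the collection of all simple undirected graphs on a fixed set of $n$ nodes having exactly $m$ edges. Starved edge with a two-layer GCN: a two-layer graph convolutional network makes the prediction for each node from its two-hop neighborhood, and the classification loss is computed only from the predictions at the labeled nodes. An edge is called starved if it does not affect this loss. For a two-layer GCN this means: an edge $\{v,u\}$ is starved if and only if neither $v$ nor $u$ is a labeled node and neither $v$ nor $u$ is adjacent in the graph to any labeled node. Convention: when $q\in\{n-1,n\}$, one of the first two factors of the formula is $0$ and the whole expression is read as $0$, even if some denominator $\binom{n}{2}-i$ vanishes. When $q\le n-2$, all denominators $\binom{n}{2}-i$ with $1\le i\le 2q$ are positive. *)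

theory Defs
  imports "HOL-Probability.Probability" "HOL-Library.Ramsey"
begin

text \<open>
  A simple undirected graph on the node set \<open>V\<close> is represented by its edge set, a set of
  two-element subsets of \<open>V\<close>; \<open>nsets A k\<close> is the set of \<open>k\<close>-element subsets of \<open>A\<close>.
\<close>

definition graphs :: "'a set \<Rightarrow> nat \<Rightarrow> 'a set set set" where
  "graphs V m = {E. E \<subseteq> nsets V 2 \<and> card E = m}"

definition erdos_renyi_pmf :: "'a set \<Rightarrow> nat \<Rightarrow> 'a set set pmf" where
  "erdos_renyi_pmf V m = pmf_of_set (graphs V m)"

definition labeled_nodes_pmf :: "'a set \<Rightarrow> nat \<Rightarrow> 'a set pmf" where
  "labeled_nodes_pmf V q = pmf_of_set (nsets V q)"

text \<open>
  With two message-passing layers the loss, which is computed at the labeled nodes \<open>L\<close> only, sees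
  exactly the edges having an endpoint that is labeled or adjacent to a labeled node. The starved
  edges are the others.
\<close>

definition starved_edge :: "'a set set \<Rightarrow> 'a set \<Rightarrow> 'a set \<Rightarrow> bool" where
  "starved_edge E L e \<longleftrightarrow> e \<in> E \<and> (\<forall>x\<in>e. x \<notin> L \<and> (\<forall>l\<in>L. {x, l} \<notin> E))"

text \<open>
  The value of \<^const>\<open>pmf_of_set\<close> is unspecified on empty or infinite sets; the following facts show
  that this does not happen for the parameters of interest.
\<close>

lemma finite_graphs: "finite V \<Longrightarrow> finite (graphs V m)"
  unfolding graphs_def
  by (rule finite_subset[of _ "Pow (nsets V 2)"]) (auto simp: finite_imp_finite_nsets)

lemma graphs_nonempty:
  assumes "finite V" "m \<le> card V choose 2"
  shows "graphs V m \<noteq> {}"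
proof -
  have "m \<le> card (nsets V 2)"
    using assms by simp
  then obtain E where "E \<subseteq> nsets V 2" "card E = m"
    by (metis obtain_subset_with_card_n)
  then show ?thesis
    by (auto simp: graphs_def)
qed

lemma set_pmf_erdos_renyi:
  assumes "finite V" "m \<le> card V choose 2"
  shows "set_pmf (erdos_renyi_pmf V m) = graphs V m"
  unfolding erdos_renyi_pmf_def
  by (rule set_pmf_of_set[OF graphs_nonempty[OF assms] finite_graphs[OF assms(1)]])

lemma set_pmf_labeled_nodes:
  assumes "finite V" "q \<le> card V"
  shows "set_pmf (labeled_nodes_pmf V q) = nsets V q"
proof -
  obtain L where "L \<subseteq> V" "card L = q" "finite L"
    using obtain_subset_with_card_n[OF assms(2)] assms(1) finite_subset by metis
  then have "nsets V q \<noteq> {}"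
    by (auto simp: nsets_def)
  then show ?thesis
    unfolding labeled_nodes_pmf_def
    by (rule set_pmf_of_set) (simp add: assms(1) finite_imp_finite_nsets)
qed

end

theory Submission
  imports Defs
begin

text \<open>
  The labeled set avoids \<open>v\<close> and \<open>u\<close> with probability \<open>(n-2 choose q) / (n choose q)\<close>. Given such
  a labeled set \<open>L\<close> and given that \<open>{v, u}\<close> is an edge, the other \<open>m - 1\<close> edges are a uniformly
  random subset of the remaining \<open>(n choose 2) - 1\<close> pairs, and the edge is starved iff they avoid
  the \<open>2q\<close> pairs joining \<open>v\<close> or \<open>u\<close> to \<open>L\<close>. Both probabilities are ratios of binomial coefficients
  \<open>(M - k choose r) / (M choose r)\<close>, which telescope into the stated products.
\<close>

text \<open>By absorption, \<open>K * (K - 1 choose r) = (K - r) * (K choose r)\<close>, so each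
  decrement of the upper index contributes one factor. The \<open>i\<close>-th decrement starts from
  \<open>K = M + 1 - i\<close>, which is positive because \<open>k \<le> M\<close>.\<close>

lemma binomial_diff_ratio:
  fixes M k r :: nat
  assumes "k \<le> M" "r \<le> M"
  shows "real ((M - k) choose r) / real (M choose r)
         = (\<Prod>i = 1..k. 1 - real r / (real M + 1 - real i))"
  using assms(1)
proof (induction k)
  case 0
  then show ?case using assms(2) by (simp add: binomial_eq_0_iff)
next
  case (Suc k)
  define K where "K = M - k"
  have K: "K > 0" "real K = real M - real k" "M - Suc k = K - 1"
    using Suc.prems by (auto simp: K_def)
  have "real K * real ((K - 1) choose r) = (real K - real r) * real (K choose r)"
  \<comment> \<open>Absorption over the naturals has a truncated \<open>K - r\<close>; for
    \<open>r > K\<close> both binomial coefficients are 0.\<close>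
  proof (cases "r \<le> K")
    case True
    then show ?thesis
      using binomial_absorb_comp[of K r] by (metis of_nat_diff of_nat_mult)
  qed (use K in \<open>simp add: binomial_eq_0\<close>)
  then have "real ((K - 1) choose r) = (real K - real r) * real (K choose r) / real K"
    using K(1) by (simp add: eq_divide_eq mult.commute)
  also have "\<dots> = real (K choose r) * (1 - real r / real K)"
    using K(1) by (simp add: diff_divide_distrib left_diff_distrib right_diff_distrib)
  finally have "real ((K - 1) choose r) = real (K choose r) * (1 - real r / real K)" .
  then have "real ((M - Suc k) choose r) / real (M choose r)
             = real ((M - k) choose r) / real (M choose r) * (1 - real r / real K)"
    by (simp add: K(3) flip: K_def)
  also have "\<dots> = (\<Prod>i = 1..Suc k. 1 - real r / (real M + 1 - real i))"
    using Suc by (simp add: K(2))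
  finally show ?case .
qed

text \<open>Deleting \<open>e\<close> leaves an arbitrary \<open>k\<close>-subset of
  \<open>A - {e} - F\<close>. With \<open>F\<close> the forbidden pairs this counts the graphs
  starving an edge, with \<open>F = {}\<close> all graphs containing it.\<close>

lemma card_subsets_containing_avoiding:
  assumes "finite A" "e \<in> A" "F \<subseteq> A - {e}"
  shows "card {E. E \<subseteq> A \<and> card E = Suc k \<and> e \<in> E \<and> E \<inter> F = {}}
         = (card A - 1 - card F) choose k"
proof -
  let ?B = "A - {e} - F"
  have fin: "finite E" if "E \<subseteq> A" for E
    using that assms(1) by (rule finite_subset)
  have "bij_betw (insert e) {E. E \<subseteq> ?B \<and> card E = k}
          {E. E \<subseteq> A \<and> card E = Suc k \<and> e \<in> E \<and> E \<inter> F = {}}"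
  proof (rule bij_betw_byWitness[where f' = "\<lambda>E. E - {e}"])
    show "insert e ` {E. E \<subseteq> ?B \<and> card E = k}
            \<subseteq> {E. E \<subseteq> A \<and> card E = Suc k \<and> e \<in> E \<and> E \<inter> F = {}}"
    proof clarify
      fix E assume E: "E \<subseteq> ?B" "k = card E"
      then have "finite E" "e \<notin> E" by (auto intro: fin)
      then show "insert e E \<subseteq> A \<and> card (insert e E) = Suc (card E) \<and> e \<in> insert e E
                 \<and> insert e E \<inter> F = {}"
        using E assms by auto
    qed
  qed (auto simp: fin)
  then have "card {E. E \<subseteq> A \<and> card E = Suc k \<and> e \<in> E \<and> E \<inter> F = {}}
             = card {E. E \<subseteq> ?B \<and> card E = k}"
    by (simp add: bij_betw_same_card)
  also have "\<dots> = card ?B choose k"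
    using assms(1) by (simp add: n_subsets)
  also have "card ?B = card A - 1 - card F"
    using assms by (simp add: card_Diff_subset finite_subset[OF assms(3)])
  finally show ?thesis .
qed

definition pairs_between :: "'a set \<Rightarrow> 'a set \<Rightarrow> 'a set set" where
  "pairs_between X L = (\<lambda>(x, l). {x, l}) ` (X \<times> L)"

text \<open>Disjointness tells the two ends of a pair apart, so no pair arises twice.\<close>

lemma card_pairs_between:
  assumes "X \<inter> L = {}"
  shows "card (pairs_between X L) = card X * card L"
proof -
  have "inj_on (\<lambda>(x, l). {x, l}) (X \<times> L)"
    using assms by (auto simp: inj_on_def doubleton_eq_iff)
  then show ?thesis
    by (simp add: pairs_between_def card_image card_cartesian_product)
qed

text \<open>Each of these pairs contains a node of \<open>L\<close>, while \<open>X\<close> contains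
  none; hence the edge \<open>X\<close> itself is never forbidden.\<close>

lemma pairs_between_subset:
  assumes "X \<subseteq> V" "L \<subseteq> V" "X \<inter> L = {}"
  shows "pairs_between X L \<subseteq> nsets V 2 - {X}"
  using assms by (auto simp: pairs_between_def nsets_def card_insert_if)

text \<open>For a fixed \<open>L\<close>, starvation becomes avoidance of a fixed set of pairs, the
  form in which graphs are counted.\<close>

lemma starved_edge_iff:
  "starved_edge E L e \<longleftrightarrow> e \<in> E \<and> e \<inter> L = {} \<and> E \<inter> pairs_between e L = {}"
  by (auto simp: starved_edge_def pairs_between_def)

lemma card_starved_pairs:
  assumes "finite V" "v \<in> V" "u \<in> V" "v \<noteq> u"
  shows "card {(E, L) \<in> graphs V (Suc k) \<times> nsets V q. starved_edge E L {v, u}}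
         = ((card V - 2) choose q) * ((card V choose 2) - 1 - 2 * q choose k)"
proof -
  let ?e = "{v, u}"
  have e: "?e \<in> nsets V 2"
    using assms by (simp add: nsets_def)
  have fin: "finite (nsets V 2)"
    using assms(1) by (rule finite_imp_finite_nsets)
  let ?G = "\<lambda>L. {E. E \<subseteq> nsets V 2 \<and> card E = Suc k \<and> ?e \<in> E \<and> E \<inter> pairs_between ?e L = {}}"
  have G: "card (?G L) = (card V choose 2) - 1 - 2 * q choose k" if "L \<in> nsets (V - ?e) q" for L
  proof -
    from that have L: "L \<subseteq> V" "?e \<inter> L = {}" "card L = q"
      by (auto simp: nsets_def)
    have "card (pairs_between ?e L) = 2 * q"
      using L assms(4) by (simp only: card_pairs_between) simp
    moreover have "pairs_between ?e L \<subseteq> nsets V 2 - {?e}"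
      using L assms by (intro pairs_between_subset) auto
    ultimately show ?thesis
      using card_subsets_containing_avoiding[OF fin e, of "pairs_between ?e L" k] by simp
  qed
  \<comment> \<open>The admissible graphs depend on \<open>L\<close>, so \<open>L\<close> has to
    come first in the \<open>Sigma\<close>; their number is the same for every \<open>L\<close>
    avoiding the edge.\<close>
  have "{(E, L) \<in> graphs V (Suc k) \<times> nsets V q. starved_edge E L ?e}
        = prod.swap ` Sigma (nsets (V - ?e) q) ?G"
    by (auto simp: starved_edge_iff graphs_def nsets_def image_iff)
  then have "card {(E, L) \<in> graphs V (Suc k) \<times> nsets V q. starved_edge E L ?e}
        = card (Sigma (nsets (V - ?e) q) ?G)"
    by (simp add: card_image)
  also have "\<dots> = (\<Sum>L \<in> nsets (V - ?e) q. card (?G L))"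
    using assms(1) fin by (intro card_SigmaI) (auto simp: finite_imp_finite_nsets)
  also have "\<dots> = ((card V - 2) choose q) * ((card V choose 2) - 1 - 2 * q choose k)"
  proof -
    have "card (V - ?e) = card V - 2"
      using assms by (simp add: card_Diff_subset)
    then show ?thesis
      by (simp add: G)
  qed
  finally show ?thesis .
qed

theorem theorem1:
  fixes V :: "'a set" and n m q :: nat and v u :: 'a
  assumes "finite V" and "card V = n"
    and "2 \<le> n"
    and "1 \<le> m" and "m \<le> n choose 2"
    and "q \<le> n"
    and "v \<in> V" and "u \<in> V" and "v \<noteq> u"
  shows "\<P>((E, L) in measure_pmf (pair_pmf (erdos_renyi_pmf V m) (labeled_nodes_pmf V q)).
            starved_edge E L {v, u} \<bar> {v, u} \<in> E)
         = (1 - real q / real n) * (1 - real q / (real n - 1)) *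
           (\<Prod>i = 1..2 * q. 1 - (real m - 1) / (real (n choose 2) - real i))"
proof -
  let ?e = "{v, u}"
  let ?S = "graphs V m \<times> nsets V q"
  let ?N = "n choose 2"
  obtain k where k: "m = Suc k"
    using \<open>1 \<le> m\<close> by (cases m) auto
  have e: "?e \<in> nsets V 2"
    using assms by (simp add: nsets_def)
  have fG: "finite (graphs V m)" and neG: "graphs V m \<noteq> {}"
    using assms finite_graphs graphs_nonempty by blast+
  have fL: "finite (nsets V q)"
    using assms(1) by (rule finite_imp_finite_nsets)
  have cL: "card (nsets V q) = n choose q"
    using assms by simp
  then have neL: "nsets V q \<noteq> {}"
    using \<open>q \<le> n\<close> by (metis card.empty binomial_eq_0_iff not_less)
  \<comment> \<open>Independent uniform choices are jointly uniform, so probabilities become ratios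
    of cardinalities.\<close>
  have pmf: "pair_pmf (erdos_renyi_pmf V m) (labeled_nodes_pmf V q) = pmf_of_set ?S"
    unfolding erdos_renyi_pmf_def labeled_nodes_pmf_def
    by (rule pmf_eqI) (auto simp: pmf_pair fG fL neG neL indicator_def split: prod.splits)
  have prob: "measure_pmf.prob (pmf_of_set ?S) {x. P x} = card {x \<in> ?S. P x} / card ?S" for P
    using fG fL neG neL by (simp add: measure_pmf_of_set Collect_conj_eq Int_commute)
  have num: "{x \<in> ?S. (case x of (E, L) \<Rightarrow> starved_edge E L ?e) \<and> (case x of (E, L) \<Rightarrow> ?e \<in> E)}
      = {(E, L) \<in> ?S. starved_edge E L ?e}"
    by (auto simp: starved_edge_def)
  \<comment> \<open>The vacuous \<open>E \<inter> {} = {}\<close> matches the counting lemma at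
    \<open>F = {}\<close>.\<close>
  have "{x \<in> ?S. case x of (E, L) \<Rightarrow> ?e \<in> E}
      = {E. E \<subseteq> nsets V 2 \<and> card E = Suc k \<and> ?e \<in> E \<and> E \<inter> {} = {}} \<times> nsets V q"
    by (auto simp: graphs_def k)
  then have den: "card {x \<in> ?S. case x of (E, L) \<Rightarrow> ?e \<in> E} = (?N - 1 choose k) * (n choose q)"
    using card_subsets_containing_avoiding[of "nsets V 2" ?e "{}" k] e assms(1,2)
    by (simp add: card_cartesian_product cL finite_imp_finite_nsets del: Int_empty_right)
  have "card ?S > 0"
    using fG fL neG assms(2,6) by (simp add: card_gt_0_iff)
  then have "\<P>((E, L) in measure_pmf (pair_pmf (erdos_renyi_pmf V m) (labeled_nodes_pmf V q)).
            starved_edge E L ?e \<bar> ?e \<in> E)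
      = real (((n - 2) choose q) * ((?N - 1 - 2 * q) choose k))
        / real ((?N - 1 choose k) * (n choose q))"
    using card_starved_pairs[OF assms(1,7-9), of k q] assms(2)
    by (simp add: cond_prob_def pmf prob num den k[symmetric])
  also have "\<dots> = real ((n - 2) choose q) / real (n choose q) *
      (real ((?N - 1 - 2 * q) choose k) / real (?N - 1 choose k))"
    by simp
  also have "real ((n - 2) choose q) / real (n choose q)
      = (1 - real q / real n) * (1 - real q / (real n - 1))"
    using binomial_diff_ratio[OF \<open>2 \<le> n\<close> \<open>q \<le> n\<close>] by (simp add: numeral_2_eq_2)
  also have "(1 - real q / real n) * (1 - real q / (real n - 1)) *
      (real ((?N - 1 - 2 * q) choose k) / real (?N - 1 choose k)) =
      (1 - real q / real n) * (1 - real q / (real n - 1)) *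
      (\<Prod>i = 1..2 * q. 1 - (real m - 1) / (real ?N - real i))"
  proof (cases "q + 2 \<le> n")
    case True
    \<comment> \<open>Pascal's rule gives \<open>?N = 2 * p + 1 + (p choose 2)\<close>, hence
      \<open>2 * q \<le> ?N - 1\<close>. The ratio lemma at \<open>M = ?N - 1\<close> then has the
      denominators \<open>?N - i\<close>.\<close>
    then obtain p where p: "n = Suc (Suc p)" "q \<le> p"
      by (intro that[of "n - 2"]) auto
    then have "2 * q \<le> ?N - 1" and N: "1 \<le> ?N"
      by (auto simp: numeral_2_eq_2)
    moreover have "k \<le> ?N - 1"
      using \<open>m \<le> ?N\<close> k by simp
    ultimately show ?thesis
      using binomial_diff_ratio[of "2 * q" "?N - 1" k] by (simp add: k of_nat_diff)
  next
    case False
    \<comment> \<open>One of the first two factors is 0, so both sides vanish whatever the product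
      is.\<close>
    then have "q = n \<or> real q = real n - 1"
      using \<open>q \<le> n\<close> \<open>2 \<le> n\<close> by auto
    then show ?thesis
      using \<open>2 \<le> n\<close> by auto
  qed
  finally show ?thesis .
qed

end
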